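(* Let $\mathcal F_1$ be the set of feasible solutions of the linear relaxation of problem (SP) (defined in the context) that satisfy all GUB cover inequalities (defined in the context), and let $\mathcal F_2$ be the set of feasible solutions of the linear relaxation of (SP) that satisfy all augmented GUB (A-GUB) inequalities (defined in the context). Then $\mathcal F_2\subseteq\mathcal F_1$.
   Context: **Networks.** Time periods $\mathcal T=\{1,\dots,T\}$ with sink period $T+1$; $\mathcal G$ is a finite set of fires; $\mathcal J$ is a finite set of crews, $J=|\mathcal J|$. Crew networks. Crew $j$ has a finite location set $\mathcal L_j$ containing its home base $b_j$, its initial location $\ell^1_j$ and the fires $\mathcal G_j\subseteq\mathcal G$ in its jurisdiction. Nodes: $\mathcal N_j=(\mathcal L_j\times\{2,\dots,T+1\}\times\{0,1\})\cup\{(\ell^1_j,1,0)\}$; a node is (location, time, rested indicator). Arcs $\mathcal A_j$: traveling arcs $(\ell_1,t_1,r)\to(\ell_2,t_2,r)$, $\ell_1\ne\ell_2$, where $t_2-t_1\geq 1$ is the travel time from $\ell_1$ to $\ell_2$ rounded up to whole periods; working arcs $(g,t,r)\to(g,t+1,r)$, $g\in\mathcal G_j$, $t\in\mathcal T$; resting arcs $(b_j,t,0)\to(b_j,t',1)$ with $t'-t\ge\gamma$ ($\gamma\geq 1$ the rest duration) and base arcs $(b_j,t,r)\to(b_j,t+1,r)$. Traveling and working arcs leaving nodes with time $>R_j$ and rested indicator $0$ are removed ($R_j$ is a given latest rest time). Each arc has a cost $c_a$. $\mathcal P_j$ (crew routes) is the set of directed paths from $(\ell^1_j,1,0)$ to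 a node of time $T+1$. $\mathcal A_j^{gt}$ is the set of arcs leaving $(g,t,0)$ or $(g,t,1)$; $A_{pgt}=1$ if route $p$ uses an arc of $\mathcal A_j^{gt}$, else $0$; $c_p$ is the sum of the arc costs of $p$. Fire networks. Fire $g$ has a finite state set $\mathcal S_g$, initial state $s^1_g$, transition functions $f_{gt}$ and a rounding map $\lceil\cdot\rceil_{\mathcal S_g}$ onto $\mathcal S_g$. Nodes: $(\mathcal S_g\times\{2,\dots,T+1\})\cup\{(s_g^1,1)\}$. There is an arc $a$ from $(s_1,t)$ to $(s_2,t+1)$ iff $\lceil f_{gt}(s_1,x)\rceil_{\mathcal S_g}=s_2$ for some $x\in\{0,\dots,J\}$, and $x_a$ is the smallest such $x$; it has a cost $d_a$. $\mathcal B_g$ is the arc set, $\mathcal B_g^t$ the arcs leaving time $t$ with $x_a>0$. $\mathcal Q_g$ (suppression plans) is the set of directed paths from $(s_g^1,1)$ to a node of time $T+1$; $B_{qt}=\sum x_a$ over arcs $a\in\mathcal B_g^t$ of $q$; $d_q$ is the sum of the arc costs of $q$. **Problem (SP).** Minimize $\sum_{j}\sum_{p\in\mathcal P_j}c_pz_p+\sum_g\sum_{q\in\mathcal Q_g}d_qy_q$ over binary $y,z$ subject to $\sum_{q\in\mathcal Q_g}y_q=1$ for all $g\in\mathcal G$; $\sum_{p\in\mathcal P_j}z_p=1$ for all $j\in\mathcal J$; and $\sum_{j}\sum_{p\in\mathcal P_j}A_{pgt}z_p-\sum_{q\in\mathcal Q_g}B_{qt}y_q\ge0$ for all $g\in\mathcal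 G,t\in\mathcal T$. The linear relaxation replaces binarity by nonnegativity. **GUB cover inequalities.** For every $t\in\mathcal T$, $\mathcal G_u\subseteq\mathcal G$, $\mathcal J_u\subseteq\mathcal J$ and $\{D_{ug}\}\in\{0,\dots,J\}^{\mathcal G_u}$ with $\sum_{g\in\mathcal G_u}D_{ug}+|\mathcal J_u|>J$: $$\sum_{g\in\mathcal G_u}\sum_{q\in\mathcal Q_g}\mathbb 1[B_{qt}\ge D_{ug}]y_q+\sum_{j\in\mathcal J_u}\sum_{p\in\mathcal P_j}\mathbb 1\Big[\sum_{g\in\mathcal G_u}A_{pgt}=0\Big]z_p\le|\mathcal G_u|+|\mathcal J_u|-1.$$ **A-GUB inequalities.** For every $t\in\mathcal T$, $\mathcal G_u\subseteq\mathcal G$, $\mathcal J_u\subseteq\mathcal J$, $\{\delta_{ugd}\}\in[0,1]^{\mathcal G_u\times\{0,\dots,J\}}$ and $K_u\in\mathbb R$ such that $\sum_{(g,d)\in S}\delta_{ugd}\le K_u$ for every $S\subseteq\mathcal G_u\times\{0,\dots,J\}$ with $\sum_{(g,d)\in S}d\le J-|\mathcal J_u|$ and $|\{(g',d)\in S:g'=g\}|\le1$ for all $g\in\mathcal G_u$: $$\sum_{g\in\mathcal G_u}\sum_{q\in\mathcal Q_g}\sum_{d=0}^{J}\mathbb 1[B_{qt}=d]\delta_{ugd}y_q+\sum_{j\in\mathcal J_u}\sum_{p\in\mathcal P_j}\mathbb 1\Big[\sum_{g\in\mathcal G_u}A_{pgt}=0\Big]z_p\le|\mathcal J_u|+K_u.$$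 *)

theory Defs
  imports Complex_Main "HOL-Library.FuncSet" "Graph_Theory.Arc_Walk"
begin

(* A crew node is (location, time, rested indicator). *)
type_synonym 'l crew_node = "'l \<times> nat \<times> nat"

(* Arcs carry their type, because the removal of arcs after the latest rest time depends on it
   and because a working arc and a base arc may have the same endpoints. *)
datatype 'l crew_arc =
    Travel (arc_tail: "'l crew_node") (arc_head: "'l crew_node")
  | Work (arc_tail: "'l crew_node") (arc_head: "'l crew_node")
  | Rest (arc_tail: "'l crew_node") (arc_head: "'l crew_node")
  | Base (arc_tail: "'l crew_node") (arc_head: "'l crew_node")

(* A fire node is (state, time). *)
type_synonym 's fire_node = "'s \<times> nat"
type_synonym 's fire_arc = "'s fire_node \<times> 's fire_node"

(* Fires are themselves locations, so they have the location type 'l.  The type 's is the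
   ambient space of fire states, in which the transition functions take unrounded values. *)
record ('l, 'j, 's) wildfire =
  horizon :: nat
  fires :: "'l set"
  crews :: "'j set"
  locations :: "'j \<Rightarrow> 'l set"
  home_base :: "'j \<Rightarrow> 'l"
  init_location :: "'j \<Rightarrow> 'l"
  jurisdiction :: "'j \<Rightarrow> 'l set"
  travel_time :: "'j \<Rightarrow> 'l \<Rightarrow> 'l \<Rightarrow> real"
  rest_duration :: nat
  latest_rest :: "'j \<Rightarrow> nat"
  crew_arc_cost :: "'j \<Rightarrow> 'l crew_arc \<Rightarrow> real"
  states :: "'l \<Rightarrow> 's set"
  init_state :: "'l \<Rightarrow> 's"
  transition :: "'l \<Rightarrow> nat \<Rightarrow> 's \<Rightarrow> nat \<Rightarrow> 's"
  round_state :: "'l \<Rightarrow> 's \<Rightarrow> 's"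
  fire_arc_cost :: "'l \<Rightarrow> 's fire_arc \<Rightarrow> real"

definition valid_wildfire :: "('l, 'j, 's) wildfire \<Rightarrow> bool" where
  "valid_wildfire W \<longleftrightarrow>
     finite (fires W) \<and> finite (crews W) \<and> 1 \<le> rest_duration W \<and>
     (\<forall>j\<in>crews W.
        finite (locations W j) \<and> home_base W j \<in> locations W j \<and>
        init_location W j \<in> locations W j \<and>
        jurisdiction W j \<subseteq> fires W \<and> jurisdiction W j \<subseteq> locations W j \<and>
        (\<forall>l\<^sub>1\<in>locations W j. \<forall>l\<^sub>2\<in>locations W j. l\<^sub>1 \<noteq> l\<^sub>2 \<longrightarrow> 0 < travel_time W j l\<^sub>1 l\<^sub>2)) \<and>
     (\<forall>g\<in>fires W.
        finite (states W g) \<and> init_state W g \<in> states W g \<and> range (round_state W g) = states W g)"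

abbreviation num_crews :: "('l, 'j, 's) wildfire \<Rightarrow> nat" where
  "num_crews W \<equiv> card (crews W)"

abbreviation periods :: "('l, 'j, 's) wildfire \<Rightarrow> nat set" where
  "periods W \<equiv> {1..horizon W}"


definition crew_start :: "('l, 'j, 's) wildfire \<Rightarrow> 'j \<Rightarrow> 'l crew_node" where
  "crew_start W j = (init_location W j, 1, 0)"

definition crew_nodes :: "('l, 'j, 's) wildfire \<Rightarrow> 'j \<Rightarrow> 'l crew_node set" where
  "crew_nodes W j = locations W j \<times> {2..horizon W + 1} \<times> {0, 1} \<union> {crew_start W j}"

definition travel_arcs :: "('l, 'j, 's) wildfire \<Rightarrow> 'j \<Rightarrow> 'l crew_arc set" where
  "travel_arcs W j =
     {Travel (l\<^sub>1, t\<^sub>1, r) (l\<^sub>2, t\<^sub>2, r) |l\<^sub>1 l\<^sub>2 t\<^sub>1 t\<^sub>2 r.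
        l\<^sub>1 \<noteq> l\<^sub>2 \<and> int t\<^sub>2 - int t\<^sub>1 = \<lceil>travel_time W j l\<^sub>1 l\<^sub>2\<rceil>}"

definition work_arcs :: "('l, 'j, 's) wildfire \<Rightarrow> 'j \<Rightarrow> 'l crew_arc set" where
  "work_arcs W j =
     {Work (g, t, r) (g, t + 1, r) |g t r. g \<in> jurisdiction W j \<and> t \<in> periods W}"

definition rest_arcs :: "('l, 'j, 's) wildfire \<Rightarrow> 'j \<Rightarrow> 'l crew_arc set" where
  "rest_arcs W j =
     {Rest (home_base W j, t, 0) (home_base W j, t', 1) |t t'. t + rest_duration W \<le> t'}"

definition base_arcs :: "('l, 'j, 's) wildfire \<Rightarrow> 'j \<Rightarrow> 'l crew_arc set" where
  "base_arcs W j = {Base (home_base W j, t, r) (home_base W j, t + 1, r) |t r. True}"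

definition late_unrested :: "('l, 'j, 's) wildfire \<Rightarrow> 'j \<Rightarrow> 'l crew_arc set" where
  "late_unrested W j = {a. \<exists>l t. arc_tail a = (l, t, 0) \<and> latest_rest W j < t}"

definition crew_arcs :: "('l, 'j, 's) wildfire \<Rightarrow> 'j \<Rightarrow> 'l crew_arc set" where
  "crew_arcs W j =
     {a \<in> ((travel_arcs W j \<union> work_arcs W j) - late_unrested W j) \<union> rest_arcs W j \<union> base_arcs W j.
        arc_tail a \<in> crew_nodes W j \<and> arc_head a \<in> crew_nodes W j}"

definition crew_network :: "('l, 'j, 's) wildfire \<Rightarrow> 'j \<Rightarrow> ('l crew_node, 'l crew_arc) pre_digraph" where
  "crew_network W j =
     \<lparr>verts = crew_nodes W j, arcs = crew_arcs W j, tail = arc_tail, head = arc_head\<rparr>"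

definition routes :: "('l, 'j, 's) wildfire \<Rightarrow> 'j \<Rightarrow> 'l crew_arc list set" where
  "routes W j =
     {p. \<exists>l r. pre_digraph.apath (crew_network W j) (crew_start W j) p (l, horizon W + 1, r)}"

definition leaving_arcs :: "('l, 'j, 's) wildfire \<Rightarrow> 'j \<Rightarrow> 'l \<Rightarrow> nat \<Rightarrow> 'l crew_arc set" where
  "leaving_arcs W j g t =
     out_arcs (crew_network W j) (g, t, 0) \<union> out_arcs (crew_network W j) (g, t, 1)"

(* A_{pgt} *)
definition works_at :: "('l, 'j, 's) wildfire \<Rightarrow> 'j \<Rightarrow> 'l crew_arc list \<Rightarrow> 'l \<Rightarrow> nat \<Rightarrow> nat" where
  "works_at W j p g t = of_bool (set p \<inter> leaving_arcs W j g t \<noteq> {})"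

definition route_cost :: "('l, 'j, 's) wildfire \<Rightarrow> 'j \<Rightarrow> 'l crew_arc list \<Rightarrow> real" where
  "route_cost W j p = (\<Sum>a\<leftarrow>p. crew_arc_cost W j a)"


definition fire_start :: "('l, 'j, 's) wildfire \<Rightarrow> 'l \<Rightarrow> 's fire_node" where
  "fire_start W g = (init_state W g, 1)"

definition fire_nodes :: "('l, 'j, 's) wildfire \<Rightarrow> 'l \<Rightarrow> 's fire_node set" where
  "fire_nodes W g = states W g \<times> {2..horizon W + 1} \<union> {fire_start W g}"

definition induces :: "('l, 'j, 's) wildfire \<Rightarrow> 'l \<Rightarrow> 's fire_arc \<Rightarrow> nat \<Rightarrow> bool" where
  "induces W g a x \<longleftrightarrow>
     (case a of ((s\<^sub>1, t), (s\<^sub>2, _)) \<Rightarrow>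
        x \<le> num_crews W \<and> round_state W g (transition W g t s\<^sub>1 x) = s\<^sub>2)"

definition fire_arcs :: "('l, 'j, 's) wildfire \<Rightarrow> 'l \<Rightarrow> 's fire_arc set" where
  "fire_arcs W g =
     {(u, v) \<in> fire_nodes W g \<times> fire_nodes W g. snd v = snd u + 1 \<and> (\<exists>x. induces W g (u, v) x)}"

(* x_a; on arcs the LEAST exists by the definition of fire_arcs *)
definition arc_crews :: "('l, 'j, 's) wildfire \<Rightarrow> 'l \<Rightarrow> 's fire_arc \<Rightarrow> nat" where
  "arc_crews W g a = (LEAST x. induces W g a x)"

definition suppression_arcs :: "('l, 'j, 's) wildfire \<Rightarrow> 'l \<Rightarrow> nat \<Rightarrow> 's fire_arc set" where
  "suppression_arcs W g t = {a \<in> fire_arcs W g. snd (fst a) = t \<and> 0 < arc_crews W g a}"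

definition fire_network :: "('l, 'j, 's) wildfire \<Rightarrow> 'l \<Rightarrow> ('s fire_node, 's fire_arc) pre_digraph" where
  "fire_network W g = \<lparr>verts = fire_nodes W g, arcs = fire_arcs W g, tail = fst, head = snd\<rparr>"

definition plans :: "('l, 'j, 's) wildfire \<Rightarrow> 'l \<Rightarrow> 's fire_arc list set" where
  "plans W g =
     {q. \<exists>s. pre_digraph.apath (fire_network W g) (fire_start W g) q (s, horizon W + 1)}"

(* B_{qt} *)
definition plan_crews :: "('l, 'j, 's) wildfire \<Rightarrow> 'l \<Rightarrow> 's fire_arc list \<Rightarrow> nat \<Rightarrow> nat" where
  "plan_crews W g q t = (\<Sum>a\<in>set q \<inter> suppression_arcs W g t. arc_crews W g a)"

definition plan_cost :: "('l, 'j, 's) wildfire \<Rightarrow> 'l \<Rightarrow> 's fire_arc list \<Rightarrow> real" where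
  "plan_cost W g q = (\<Sum>a\<leftarrow>q. fire_arc_cost W g a)"


(* A solution is a pair (z, y); z is indexed by the pairs (j, p) with p a route of crew j,
   y by the pairs (g, q) with q a suppression plan of fire g. *)
type_synonym ('l, 'j, 's) solution =
  "('j \<times> 'l crew_arc list \<Rightarrow> real) \<times> ('l \<times> 's fire_arc list \<Rightarrow> real)"

definition sp_objective :: "('l, 'j, 's) wildfire \<Rightarrow> ('l, 'j, 's) solution \<Rightarrow> real" where
  "sp_objective W = (\<lambda>(z, y).
     (\<Sum>j\<in>crews W. \<Sum>p\<in>routes W j. route_cost W j p * z (j, p)) +
     (\<Sum>g\<in>fires W. \<Sum>q\<in>plans W g. plan_cost W g q * y (g, q)))"

(* Solutions with all variables in V: V = {0, 1} is the binary problem, V = {0..} its linear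
   relaxation.  The extensional function space makes solutions exactly vectors over the
   index sets. *)
definition sp_solutions :: "('l, 'j, 's) wildfire \<Rightarrow> real set \<Rightarrow> ('l, 'j, 's) solution set" where
  "sp_solutions W V = {(z, y).
     z \<in> (SIGMA j:crews W. routes W j) \<rightarrow>\<^sub>E V \<and>
     y \<in> (SIGMA g:fires W. plans W g) \<rightarrow>\<^sub>E V \<and>
     (\<forall>g\<in>fires W. (\<Sum>q\<in>plans W g. y (g, q)) = 1) \<and>
     (\<forall>j\<in>crews W. (\<Sum>p\<in>routes W j. z (j, p)) = 1) \<and>
     (\<forall>g\<in>fires W. \<forall>t\<in>periods W.
        0 \<le> (\<Sum>j\<in>crews W. \<Sum>p\<in>routes W j. real (works_at W j p g t) * z (j, p))
          - (\<Sum>q\<in>plans W g. real (plan_crews W g q t) * y (g, q)))}"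

abbreviation sp_feasible :: "('l, 'j, 's) wildfire \<Rightarrow> ('l, 'j, 's) solution set" where
  "sp_feasible W \<equiv> sp_solutions W {0, 1}"

abbreviation sp_relaxation :: "('l, 'j, 's) wildfire \<Rightarrow> ('l, 'j, 's) solution set" where
  "sp_relaxation W \<equiv> sp_solutions W {0..}"

definition gub_cover :: "('l, 'j, 's) wildfire \<Rightarrow> ('l, 'j, 's) solution \<Rightarrow> bool" where
  "gub_cover W = (\<lambda>(z, y).
     \<forall>t\<in>periods W. \<forall>Gu Ju D.
       Gu \<subseteq> fires W \<and> Ju \<subseteq> crews W \<and> D \<in> Gu \<rightarrow> {0..num_crews W} \<and>
       (\<Sum>g\<in>Gu. D g) + card Ju > num_crews W \<longrightarrow>
       (\<Sum>g\<in>Gu. \<Sum>q\<in>plans W g. of_bool (plan_crews W g q t \<ge> D g) * y (g, q)) +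
       (\<Sum>j\<in>Ju. \<Sum>p\<in>routes W j. of_bool ((\<Sum>g\<in>Gu. works_at W j p g t) = 0) * z (j, p))
       \<le> real (card Gu) + real (card Ju) - 1)"

definition a_gub :: "('l, 'j, 's) wildfire \<Rightarrow> ('l, 'j, 's) solution \<Rightarrow> bool" where
  "a_gub W = (\<lambda>(z, y).
     \<forall>t\<in>periods W. \<forall>Gu Ju (\<delta> :: 'l \<Rightarrow> nat \<Rightarrow> real) (K :: real).
       Gu \<subseteq> fires W \<and> Ju \<subseteq> crews W \<and>
       (\<forall>g\<in>Gu. \<forall>d\<in>{0..num_crews W}. \<delta> g d \<in> {0..1}) \<and>
       (\<forall>S. S \<subseteq> Gu \<times> {0..num_crews W} \<and>
            int (\<Sum>(g, d)\<in>S. d) \<le> int (num_crews W) - int (card Ju) \<and>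
            (\<forall>g\<in>Gu. card {(g', d) \<in> S. g' = g} \<le> 1) \<longrightarrow>
            (\<Sum>(g, d)\<in>S. \<delta> g d) \<le> K) \<longrightarrow>
       (\<Sum>g\<in>Gu. \<Sum>q\<in>plans W g. \<Sum>d=0..num_crews W. of_bool (plan_crews W g q t = d) * \<delta> g d * y (g, q)) +
       (\<Sum>j\<in>Ju. \<Sum>p\<in>routes W j. of_bool ((\<Sum>g\<in>Gu. works_at W j p g t) = 0) * z (j, p))
       \<le> real (card Ju) + K)"

definition F\<^sub>1 :: "('l, 'j, 's) wildfire \<Rightarrow> ('l, 'j, 's) solution set" where
  "F\<^sub>1 W = {x \<in> sp_relaxation W. gub_cover W x}"

definition F\<^sub>2 :: "('l, 'j, 's) wildfire \<Rightarrow> ('l, 'j, 's) solution set" where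
  "F\<^sub>2 W = {x \<in> sp_relaxation W. a_gub W x}"

end

theory Submission
  imports Defs
begin

text \<open>
  Every GUB cover inequality is an A-GUB inequality in disguise. Given cover data \<open>D\<close>, take
  \<open>\<delta> g d = of_bool (D g \<le> d)\<close> and \<open>K = card Gu - 1\<close>.

  These coefficients are admissible: a selection \<open>S\<close> of at most one demand per fire attains
  weight \<open>card Gu\<close> only if it picks a demand of at least \<open>D g\<close> for every fire \<open>g\<close>, and then it needs
  at least \<open>\<Sum>g\<in>Gu. D g\<close> crews, which by the cover condition exceeds the \<open>J - card Ju\<close> crews at
  hand (lemma \<open>cover_selection_weight\<close>).

  With these coefficients both inequalities have the same left-hand side. The A-GUB inequality
  groups plans by the exact demand \<open>d \<in> {0..J}\<close>, so this requires that no plan demands more than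
  \<open>J\<close> crews in one period (lemma \<open>plan_crews_le_num_crews\<close>). That holds because every arc of
  a fire network advances time by one period: a plan uses at most one arc per period, and an arc
  demands at most \<open>J\<close> crews.
\<close>

text \<open>Time grows strictly along a walk in a fire network. The lower bound on the times serves to
  carry the induction.\<close>

lemma fire_walk_times:
  assumes "pre_digraph.cas (fire_network W g) u q v" "set q \<subseteq> fire_arcs W g"
  shows "sorted_wrt (<) (map (\<lambda>a. snd (fst a)) q) \<and> (\<forall>a\<in>set q. snd u \<le> snd (fst a))"
  using assms
proof (induction q arbitrary: u)
  case Nil
  then show ?case by simp
next
  case (Cons a q)
  have a: "fst a = u" "snd (snd a) = snd u + 1"
    and walk: "pre_digraph.cas (fire_network W g) (snd a) q v"
    using Cons.prems
    by (auto simp: pre_digraph.cas.simps fire_network_def fire_arcs_def)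
  have later: "sorted_wrt (<) (map (\<lambda>a. snd (fst a)) q) \<and> (\<forall>b\<in>set q. snd (snd a) \<le> snd (fst b))"
    using Cons.IH[OF walk] Cons.prems(2) by simp
  then have "snd u < snd (fst b)" if "b \<in> set q" for b
    using that a(2) by fastforce
  with a later show ?case by (auto intro: less_imp_le)
qed

lemma plan_arcs_at_time_unique:
  assumes "q \<in> plans W g" "a \<in> set q" "b \<in> set q" "snd (fst a) = snd (fst b)"
  shows "a = b"
proof -
  obtain v where "pre_digraph.cas (fire_network W g) (fire_start W g) q v"
    and "set q \<subseteq> fire_arcs W g"
    using assms(1)
    by (auto simp: plans_def pre_digraph.apath_def pre_digraph.awalk_def fire_network_def)
  then have "sorted_wrt (<) (map (\<lambda>a. snd (fst a)) q)"
    by (rule fire_walk_times[THEN conjunct1])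
  then have "inj_on (\<lambda>a. snd (fst a)) (set q)"
    by (simp add: strict_sorted_iff distinct_map)
  then show ?thesis
    using assms by (auto dest: inj_onD)
qed

lemma arc_crews_le_num_crews:
  assumes "a \<in> fire_arcs W g"
  shows "arc_crews W g a \<le> num_crews W"
proof -
  obtain x where "induces W g a x"
    using assms by (auto simp: fire_arcs_def)
  then have "induces W g a (arc_crews W g a)"
    unfolding arc_crews_def by (rule LeastI)
  then show ?thesis
    by (auto simp: induces_def split: prod.splits)
qed

lemma plan_crews_le_num_crews:
  assumes "q \<in> plans W g"
  shows "plan_crews W g q t \<le> num_crews W"
proof (cases "set q \<inter> suppression_arcs W g t = {}")
  case True
  then show ?thesis by (simp add: plan_crews_def)
next
  case False
  then obtain a where a: "a \<in> set q" "a \<in> suppression_arcs W g t"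
    by blast
  then have "set q \<inter> suppression_arcs W g t = {a}"
    using plan_arcs_at_time_unique[OF assms] unfolding suppression_arcs_def by blast
  with a show ?thesis
    using arc_crews_le_num_crews[of a W g] by (simp add: plan_crews_def suppression_arcs_def)
qed

text \<open>The selected pairs \<open>(g, d)\<close> with \<open>D g \<le> d\<close> belong to distinct elements of \<open>G\<close>. If there were
  \<open>card G\<close> of them, all of \<open>G\<close> would be covered and the total \<open>\<Sum>d\<close> could not stay below \<open>\<Sum>D\<close>.\<close>

lemma cover_selection_weight:
  fixes D :: "'a \<Rightarrow> nat"
  assumes "finite G" "finite S" and sub: "fst ` S \<subseteq> G"
    and choice: "\<And>g. g \<in> G \<Longrightarrow> card {(g', d) \<in> S. g' = g} \<le> 1"
    and short: "(\<Sum>(g, d)\<in>S. d) < (\<Sum>g\<in>G. D g)"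
  shows "(\<Sum>(g, d)\<in>S. of_bool (D g \<le> d)) \<le> real (card G) - 1"
proof -
  define C where "C = {(g, d) \<in> S. D g \<le> d}"
  have "C \<subseteq> S" and [simp]: "finite C"
    using \<open>finite S\<close> by (auto simp: C_def intro: rev_finite_subset)
  have "inj_on fst S"
  proof (rule inj_onI)
    fix x y assume xy: "x \<in> S" "y \<in> S" "fst x = fst y"
    have "finite {(g', d) \<in> S. g' = fst x}"
      using \<open>finite S\<close> by (auto intro: rev_finite_subset)
    moreover have "fst x \<in> G" using xy sub by auto
    ultimately have "\<forall>a \<in> {(g', d) \<in> S. g' = fst x}. \<forall>b \<in> {(g', d) \<in> S. g' = fst x}. a = b"
      using choice[of "fst x"] card_le_Suc0_iff_eq[of "{(g', d) \<in> S. g' = fst x}"]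
      unfolding One_nat_def by blast
    then show "x = y"
      using xy by (cases x; cases y) auto
  qed
  with \<open>C \<subseteq> S\<close> have inj: "inj_on fst C"
    by (rule inj_on_subset[rotated])
  have "fst ` C \<noteq> G"
  proof
    assume "fst ` C = G"
    then have "(\<Sum>g\<in>G. D g) = (\<Sum>x\<in>C. D (fst x))"
      using inj by (auto simp: sum.reindex)
    also have "\<dots> \<le> (\<Sum>x\<in>C. snd x)"
      by (rule sum_mono) (auto simp: C_def)
    also have "\<dots> \<le> (\<Sum>x\<in>S. snd x)"
      using \<open>C \<subseteq> S\<close> \<open>finite S\<close> by (intro sum_mono2) auto
    finally show False
      using short by (simp add: case_prod_unfold)
  qed
  with sub \<open>C \<subseteq> S\<close> have "fst ` C \<subset> G" by blast
  then have "card C < card G"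
    using psubset_card_mono[OF \<open>finite G\<close>] card_image[OF inj] by metis
  moreover have "(\<Sum>(g, d)\<in>S. of_bool (D g \<le> d)) = real (card C)"
    using \<open>finite S\<close> by (simp add: C_def case_prod_unfold of_bool_def sum.If_cases Int_def)
  ultimately show ?thesis by linarith
qed

lemma a_gub_imp_gub_cover:
  fixes W :: "('l, 'j, 's) wildfire"
  assumes "finite (fires W)" and "a_gub W (z, y)"
  shows "gub_cover W (z, y)"
  unfolding gub_cover_def prod.case
proof (intro ballI allI impI, elim conjE)
  fix t Gu Ju and D :: "'l \<Rightarrow> nat"
  assume t: "t \<in> periods W" and Gu: "Gu \<subseteq> fires W" and Ju: "Ju \<subseteq> crews W"
    and cover: "(\<Sum>g\<in>Gu. D g) + card Ju > num_crews W"
  let ?J = "num_crews W"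
  define \<delta> :: "'l \<Rightarrow> nat \<Rightarrow> real" where "\<delta> g d = of_bool (D g \<le> d)" for g d
  define crew_part where
    "crew_part = (\<Sum>j\<in>Ju. \<Sum>p\<in>routes W j. of_bool ((\<Sum>g\<in>Gu. works_at W j p g t) = 0) * z (j, p))"
  have "finite Gu" using Gu assms(1) by (rule finite_subset)
  have admissible: "(\<Sum>(g, d)\<in>S. \<delta> g d) \<le> real (card Gu) - 1"
    if S: "S \<subseteq> Gu \<times> {0..?J}" "int (\<Sum>(g, d)\<in>S. d) \<le> int ?J - int (card Ju)"
      and choice: "\<forall>g\<in>Gu. card {(g', d) \<in> S. g' = g} \<le> 1" for S
    unfolding \<delta>_def
  proof (rule cover_selection_weight)
    show "finite S"
      using S(1) \<open>finite Gu\<close> by (auto intro: finite_subset)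
    show "(\<Sum>(g, d)\<in>S. d) < (\<Sum>g\<in>Gu. D g)"
      using S(2) cover by linarith
  qed (use \<open>finite Gu\<close> S choice in auto)
  have a_gub_instance:
    "(\<Sum>g\<in>Gu. \<Sum>q\<in>plans W g. \<Sum>d=0..?J. of_bool (plan_crews W g q t = d) * \<delta> g d * y (g, q))
      + crew_part \<le> real (card Ju) + (real (card Gu) - 1)"
    unfolding crew_part_def
    using assms(2)[unfolded a_gub_def prod.case, rule_format,
        of t Gu Ju \<delta> "real (card Gu) - 1"] t Gu Ju admissible
    by (simp add: \<delta>_def)
  have collapse: "(\<Sum>d=0..?J. of_bool (plan_crews W g q t = d) * \<delta> g d * y (g, q))
      = of_bool (plan_crews W g q t \<ge> D g) * y (g, q)"
    if "q \<in> plans W g" for g q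
  proof -
    have "(\<Sum>d=0..?J. of_bool (plan_crews W g q t = d) * \<delta> g d * y (g, q))
        = (\<Sum>d=0..?J. if plan_crews W g q t = d then \<delta> g d * y (g, q) else 0)"
      by (rule sum.cong) auto
    also have "\<dots> = \<delta> g (plan_crews W g q t) * y (g, q)"
      using plan_crews_le_num_crews[OF that] by simp
    finally show ?thesis by (simp add: \<delta>_def)
  qed
  have "(\<Sum>g\<in>Gu. \<Sum>q\<in>plans W g. of_bool (plan_crews W g q t \<ge> D g) * y (g, q)) + crew_part
      \<le> real (card Gu) + real (card Ju) - 1"
    using a_gub_instance by (simp add: collapse)
  then show "(\<Sum>g\<in>Gu. \<Sum>q\<in>plans W g. of_bool (plan_crews W g q t \<ge> D g) * y (g, q)) +
      (\<Sum>j\<in>Ju. \<Sum>p\<in>routes W j. of_bool ((\<Sum>g\<in>Gu. works_at W j p g t) = 0) * z (j, p))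
      \<le> real (card Gu) + real (card Ju) - 1"
    by (simp only: crew_part_def)
qed

theorem proposition3:
  fixes W :: "('l, 'j, 's) wildfire"
  assumes "valid_wildfire W"
  shows "F\<^sub>2 W \<subseteq> F\<^sub>1 W"
  using assms a_gub_imp_gub_cover
  by (auto simp: F\<^sub>1_def F\<^sub>2_def valid_wildfire_def)

end
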